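(* Let $(\mathcal{T}_n)_{n\ge1}$ be a sequence of size-conditioned simply generated trees of type I, II or III. Then there are constants $n_0\ge1$ and $C,c>0$, depending only on the weight sequence, such that \[ \mathbf P\bigl(\partial(\mathcal{T}_n)\ge k\bigr)\le Ce^{-ck}\qquad\text{for any } n\ge n_0 \text{ (for which }\mathcal{T}_n\text{ is defined) and any } k\ge0. \]
   Context: **Simply generated trees.** A weight sequence is a sequence $\mathbf w=(\omega_k)_{k\ge0}$ of non-negative reals with $\omega_0>0$ and $\omega_k>0$ for at least one $k\ge2$. For $n\ge 1$, $\mathcal{T}_n$ is the random rooted plane tree with $n$ vertices such that $\mathbf P(\mathcal{T}_n=T)$ is proportional to $\prod_{v\in T}\omega_{d_T^+(v)}$ for each $n$-vertex rooted plane tree $T$, where $d_T^+(v)$ is the outdegree (number of children) of $v$. Throughout, only those $n$ are considered for which some $n$-vertex tree has positive weight ("$\mathcal{T}_n$ is defined"). **Types.** Let $\Phi(z)=\sum_{k\ge0}\omega_kz^k$ with radius of convergence $R\in[0,\infty]$. Type I: there is a (finite) $\tau\in(0,R]$ with $\Phi(\tau)<\infty$ and $\tau\Phi'(\tau)/\Phi(\tau)=1$. Type II: $R>0$, $\Phi(R)<\infty$ and $R\Phi'(R)/\Phi(R)<1$. Type III: $R=0$. **Distance to the border.** A leaf is a vertex with no children. For a rooted tree $T$, $\partial(T)$ is the minimal graph distance from the root to a leaf of $T$. *)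

theory Defs
  imports "HOL-Probability.Probability"
begin

datatype plane_tree = Node (subtrees: "plane_tree list")

text \<open>
  Vertices are Ulam--Harris words: the root is \<open>[]\<close>, and the children of \<open>v\<close> are the
  vertices \<open>v @ [i]\<close>, ordered by \<open>i = 0, 1, \<dots>\<close>.
\<close>

primrec is_vertex :: "nat list \<Rightarrow> plane_tree \<Rightarrow> bool" where
  "is_vertex [] T \<longleftrightarrow> True"
| "is_vertex (i # v) T \<longleftrightarrow> i < length (subtrees T) \<and> is_vertex v (subtrees T ! i)"

definition vertices :: "plane_tree \<Rightarrow> nat list set" where
  "vertices T = {v. is_vertex v T}"

definition outdegree :: "plane_tree \<Rightarrow> nat list \<Rightarrow> nat" where
  "outdegree T v = card {i. v @ [i] \<in> vertices T}"

definition edges :: "plane_tree \<Rightarrow> (nat list \<times> nat list) set" where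
  "edges T = {(v, v @ [i]) |v i. v @ [i] \<in> vertices T}"

definition graph_distance :: "plane_tree \<Rightarrow> nat list \<Rightarrow> nat list \<Rightarrow> nat" where
  "graph_distance T u v = (LEAST m. (u, v) \<in> (edges T \<union> (edges T)\<inverse>) ^^ m)"

definition leaves :: "plane_tree \<Rightarrow> nat list set" where
  "leaves T = {v \<in> vertices T. outdegree T v = 0}"

definition border_distance :: "plane_tree \<Rightarrow> nat" where
  "border_distance T = (MIN v\<in>leaves T. graph_distance T [] v)"


definition weight_sequence :: "(nat \<Rightarrow> real) \<Rightarrow> bool" where
  "weight_sequence w \<longleftrightarrow> (\<forall>k. w k \<ge> 0) \<and> w 0 > 0 \<and> (\<exists>k\<ge>2. w k > 0)"

definition tree_weight :: "(nat \<Rightarrow> real) \<Rightarrow> plane_tree \<Rightarrow> real" where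
  "tree_weight w T = (\<Prod>v\<in>vertices T. w (outdegree T v))"

definition plane_trees :: "nat \<Rightarrow> plane_tree set" where
  "plane_trees n = {T. card (vertices T) = n}"

definition partition_function :: "(nat \<Rightarrow> real) \<Rightarrow> nat \<Rightarrow> real" where
  "partition_function w n = (\<Sum>T\<in>plane_trees n. tree_weight w T)"

definition sg_defined :: "(nat \<Rightarrow> real) \<Rightarrow> nat \<Rightarrow> bool" where
  "sg_defined w n \<longleftrightarrow> (\<exists>T\<in>plane_trees n. tree_weight w T > 0)"

text \<open>
  The law of the random tree. It is meaningful only if \<open>sg_defined w n\<close> holds; see
  \<open>pmf_simply_generated_tree\<close>.
\<close>

definition simply_generated_tree :: "(nat \<Rightarrow> real) \<Rightarrow> nat \<Rightarrow> plane_tree pmf" where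
  "simply_generated_tree w n =
     embed_pmf (\<lambda>T. if T \<in> plane_trees n then tree_weight w T / partition_function w n else 0)"


definition gen_fun :: "(nat \<Rightarrow> real) \<Rightarrow> real \<Rightarrow> real" where
  "gen_fun w z = (\<Sum>k. w k * z ^ k)"

definition gen_fun_deriv :: "(nat \<Rightarrow> real) \<Rightarrow> real \<Rightarrow> real" where
  "gen_fun_deriv w z = (\<Sum>k. diffs w k * z ^ k)"

text \<open>
  At the radius of convergence, the series of \<open>\<Phi>\<close> and of its derivative may diverge, in which
  case their value is \<open>\<infinity>\<close>. The conditions \<open>\<tau> \<Phi>'(\<tau>) / \<Phi>(\<tau>) = 1\<close> and
  \<open>R \<Phi>'(R) / \<Phi>(R) < 1\<close> include that \<open>\<Phi>'\<close> is finite there, which is the second summability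
  condition below.
\<close>

definition type_I :: "(nat \<Rightarrow> real) \<Rightarrow> bool" where
  "type_I w \<longleftrightarrow> (\<exists>\<tau>>0. ereal \<tau> \<le> conv_radius w \<and>
     summable (\<lambda>k. w k * \<tau> ^ k) \<and> summable (\<lambda>k. diffs w k * \<tau> ^ k) \<and>
     \<tau> * gen_fun_deriv w \<tau> / gen_fun w \<tau> = 1)"

text \<open>
  The radius of convergence is finite in type II: a weight sequence has a positive weight
  at some \<open>k \<ge> 2\<close>, so \<open>\<Phi>(\<infinity>) = \<infinity>\<close>.
\<close>

definition type_II :: "(nat \<Rightarrow> real) \<Rightarrow> bool" where
  "type_II w \<longleftrightarrow> (\<exists>R>0. conv_radius w = ereal R \<and>
     summable (\<lambda>k. w k * R ^ k) \<and> summable (\<lambda>k. diffs w k * R ^ k) \<and>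
     R * gen_fun_deriv w R / gen_fun w R < 1)"

definition type_III :: "(nat \<Rightarrow> real) \<Rightarrow> bool" where
  "type_III w \<longleftrightarrow> conv_radius w = 0"


lemma vertices_Node:
  "vertices (Node ts) = insert [] (\<Union>i<length ts. (#) i ` vertices (ts ! i))"
proof (intro set_eqI)
  fix v show "v \<in> vertices (Node ts) \<longleftrightarrow> v \<in> insert [] (\<Union>i<length ts. (#) i ` vertices (ts ! i))"
    by (cases v) (auto simp: vertices_def)
qed

lemma finite_vertices: "finite (vertices T)"
proof (induction T)
  case (Node ts)
  then show ?case by (auto simp: vertices_Node)
qed

lemma card_vertices_child_less:
  assumes "t \<in> set ts"
  shows "card (vertices t) < card (vertices (Node ts))"
proof -
  obtain i where i: "i < length ts" "t = ts ! i"
    using assms by (metis in_set_conv_nth)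
  have "card (vertices t) = card ((#) i ` vertices t)"
    by (simp add: card_image)
  also have "\<dots> < card (vertices (Node ts))"
    using i by (intro psubset_card_mono finite_vertices) (auto simp: vertices_Node)
  finally show ?thesis .
qed

lemma length_subtrees_less: "length ts < card (vertices (Node ts))"
proof -
  have "length ts = card ((\<lambda>i. [i]) ` {..<length ts})"
    by (simp add: card_image inj_on_def)
  also have "\<dots> < card (vertices (Node ts))"
    by (intro psubset_card_mono finite_vertices) (auto simp: vertices_def)
  finally show ?thesis .
qed

lemma finite_plane_trees: "finite (plane_trees n)"
proof -
  have "finite {T. card (vertices T) \<le> m}" for m
  proof (induction m)
    case 0
    have "card (vertices T) > 0" for T
      using length_subtrees_less[of "subtrees T"] by (simp del: card_gt_0_iff)
    then have "{T. card (vertices T) \<le> 0} = {}"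
      by (metis (mono_tags, lifting) Collect_empty_eq not_le)
    then show ?case by (metis finite.emptyI)
  next
    case (Suc m)
    have "{T. card (vertices T) \<le> Suc m} \<subseteq>
        Node ` {ts. set ts \<subseteq> {T. card (vertices T) \<le> m} \<and> length ts \<le> m}"
    proof
      fix T assume T: "T \<in> {T. card (vertices T) \<le> Suc m}"
      obtain ts where ts: "T = Node ts" by (cases T)
      show "T \<in> Node ` {ts. set ts \<subseteq> {T. card (vertices T) \<le> m} \<and> length ts \<le> m}"
        using T card_vertices_child_less[of _ ts] length_subtrees_less[of ts]
        unfolding ts by force
    qed
    then show ?case
      using finite_lists_length_le[OF Suc] by (meson finite_imageI finite_subset)
  qed
  from this[of n] show ?thesis
    by (rule rev_finite_subset) (auto simp: plane_trees_def)
qed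

lemma pmf_simply_generated_tree:
  assumes "weight_sequence w" and "sg_defined w n"
  shows "pmf (simply_generated_tree w n) T =
    (if T \<in> plane_trees n then tree_weight w T / partition_function w n else 0)"
proof -
  let ?f = "\<lambda>T. if T \<in> plane_trees n then tree_weight w T / partition_function w n else 0"
  have nonneg: "tree_weight w T \<ge> 0" for T
    using assms(1) by (auto simp: tree_weight_def weight_sequence_def intro!: prod_nonneg)
  obtain T0 where "T0 \<in> plane_trees n" "tree_weight w T0 > 0"
    using assms(2) by (auto simp: sg_defined_def)
  then have pos: "partition_function w n > 0"
    unfolding partition_function_def using nonneg by (intro sum_pos2[of _ T0] finite_plane_trees)
  have "(\<integral>\<^sup>+ T. ennreal (?f T) \<partial>count_space UNIV) = (\<Sum>T\<in>plane_trees n. ennreal (?f T))"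
    by (rule nn_integral_count_space'[OF finite_plane_trees]) auto
  also have "\<dots> = ennreal (\<Sum>T\<in>plane_trees n. ?f T)"
    using nonneg pos by (intro sum_ennreal) auto
  also have "(\<Sum>T\<in>plane_trees n. ?f T) = 1"
    using pos by (simp add: partition_function_def flip: sum_divide_distrib)
  finally have "(\<integral>\<^sup>+ T. ennreal (?f T) \<partial>count_space UNIV) = 1" by simp
  then show ?thesis
    unfolding simply_generated_tree_def using nonneg pos by (subst pmf_embed_pmf) auto
qed

end

theory Submission
  imports Defs "HOL-Computational_Algebra.Formal_Power_Series"
begin

unbundle fps_syntax
unbundle no vec_syntax

text \<open>
  If \<open>\<partial>(T) \<ge> k\<close>, then the leftmost path from the root has at least \<open>k\<close> edges, so that the first \<open>k\<close>
  outdegrees in depth-first order are nonzero. Among the \<open>n\<close>-vertex trees with \<open>l\<close> leaves, the hitting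
  time theorem for forests shows that the proportion of such trees is at most
  \<open>(k + 1) n / (n - k) \<cdot> (1 - l / n) ^ (k - 1)\<close>. It remains to exclude trees with few leaves. Such a tree
  has almost only vertices of outdegree 1, and replacing \<open>j + 1\<close> of these by one vertex of outdegree
  \<open>j + 1\<close> and \<open>j\<close> leaves can be done in so many ways that the total weight at least doubles; hence
  having fewer than \<open>\<delta> n\<close> leaves is exponentially unlikely in \<open>n\<close>, and therefore in \<open>k \<le> n\<close>.
\<close>

section \<open>Vertices, outdegrees and weights by recursion on the tree\<close>

lemma Cons_mem_vertices_Node:
  "i # v \<in> vertices (Node ts) \<longleftrightarrow> i < length ts \<and> v \<in> vertices (ts ! i)"
  by (simp add: vertices_def)

lemma Nil_mem_vertices: "[] \<in> vertices T"
  by (simp add: vertices_def)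

lemma outdegree_Nil: "outdegree (Node ts) [] = length ts"
proof -
  have "{i. [] @ [i] \<in> vertices (Node ts)} = {..<length ts}"
    by (auto simp: Cons_mem_vertices_Node Nil_mem_vertices)
  then show ?thesis by (simp add: outdegree_def)
qed

lemma outdegree_Cons:
  "i < length ts \<Longrightarrow> outdegree (Node ts) (i # v) = outdegree (ts ! i) v"
  by (simp add: outdegree_def Cons_mem_vertices_Node)

lemma disjoint_child_vertices:
  "disjoint_family_on (\<lambda>i. (#) i ` vertices (ts ! i)) {..<length ts}"
  by (auto simp: disjoint_family_on_def)

lemma card_vertices_Node:
  "card (vertices (Node ts)) = Suc (\<Sum>t\<leftarrow>ts. card (vertices t))"
proof -
  have "card (vertices (Node ts)) = Suc (card (\<Union>i<length ts. (#) i ` vertices (ts ! i)))"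
    unfolding vertices_Node by (subst card_insert_disjoint) (auto simp: finite_vertices)
  also have "card (\<Union>i<length ts. (#) i ` vertices (ts ! i)) = (\<Sum>i<length ts. card (vertices (ts ! i)))"
    using disjoint_child_vertices[of ts]
    by (subst card_UN_disjoint) (auto simp: finite_vertices card_image disjoint_family_on_def)
  also have "\<dots> = (\<Sum>t\<leftarrow>ts. card (vertices t))"
    by (simp add: sum_list_sum_nth atLeast0LessThan)
  finally show ?thesis .
qed

lemma tree_weight_Node:
  "tree_weight w (Node ts) = w (length ts) * (\<Prod>t\<leftarrow>ts. tree_weight w t)"
proof -
  have "tree_weight w (Node ts) = w (length ts) *
      (\<Prod>v\<in>(\<Union>i<length ts. (#) i ` vertices (ts ! i)). w (outdegree (Node ts) v))"
    unfolding tree_weight_def vertices_Node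
    by (subst prod.insert) (auto simp: finite_vertices outdegree_Nil)
  also have "(\<Prod>v\<in>(\<Union>i<length ts. (#) i ` vertices (ts ! i)). w (outdegree (Node ts) v)) =
      (\<Prod>i<length ts. \<Prod>v\<in>(#) i ` vertices (ts ! i). w (outdegree (Node ts) v))"
    using disjoint_child_vertices[of ts]
    by (intro prod.UNION_disjoint) (auto simp: finite_vertices disjoint_family_on_def)
  also have "\<dots> = (\<Prod>i<length ts. tree_weight w (ts ! i))"
    unfolding tree_weight_def
    by (rule prod.cong[OF refl], subst prod.reindex) (auto simp: outdegree_Cons)
  also have "\<dots> = (\<Prod>t\<leftarrow>ts. tree_weight w t)"
    by (simp add: prod.list_conv_set_nth atLeast0LessThan)
  finally show ?thesis .
qed

section \<open>The leftmost path and the distance to the border\<close>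

text \<open>Following first children only, this is weaker than
  \<open>k \<le> border_distance T\<close>, but it is a condition on the first \<open>k\<close>
  outdegrees in depth-first order: none of them is zero.\<close>

primrec leftmost_path_ge :: "nat \<Rightarrow> plane_tree \<Rightarrow> bool" where
  "leftmost_path_ge 0 T \<longleftrightarrow> True"
| "leftmost_path_ge (Suc k) T \<longleftrightarrow> subtrees T \<noteq> [] \<and> leftmost_path_ge k (hd (subtrees T))"

lemma leftmost_leaf:
  "\<not> leftmost_path_ge k T \<Longrightarrow> \<exists>j<k. replicate j 0 \<in> leaves T"
proof (induction k arbitrary: T)
  case (Suc k)
  obtain ts where T: "T = Node ts" by (cases T)
  show ?case
  proof (cases ts)
    case Nil
    then have "replicate 0 0 \<in> leaves T"
      by (simp add: leaves_def T Nil_mem_vertices outdegree_Nil)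
    then show ?thesis by blast
  next
    case (Cons t us)
    then obtain j where "j < k" "replicate j 0 \<in> leaves t"
      using Suc T by auto
    then have "replicate (Suc j) 0 \<in> leaves T"
      by (simp add: leaves_def T Cons Cons_mem_vertices_Node outdegree_Cons)
    with \<open>j < k\<close> show ?thesis by (meson Suc_mono)
  qed
qed auto

lemma is_vertex_appendD: "is_vertex (u @ v) T \<Longrightarrow> is_vertex u T"
  by (induction u arbitrary: T) auto

lemma graph_distance_root_le:
  assumes "v \<in> vertices T"
  shows "graph_distance T [] v \<le> length v"
proof -
  have "v \<in> vertices T \<Longrightarrow> ([], v) \<in> (edges T \<union> (edges T)\<inverse>) ^^ length v"
  proof (induction v rule: rev_induct)
    case (snoc i v)
    then have "v \<in> vertices T"
      using is_vertex_appendD by (auto simp: vertices_def)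
    moreover have "(v, v @ [i]) \<in> edges T"
      using snoc.prems by (auto simp: edges_def)
    ultimately show ?case using snoc.IH by auto
  qed auto
  then show ?thesis
    unfolding graph_distance_def using assms by (intro Least_le)
qed

text \<open>If the path of first children stopped after \<open>j < k\<close> steps, its end would be
  a leaf at depth \<open>j\<close>, and the path down to it bounds its distance by
  \<open>j\<close>.\<close>

lemma leftmost_path_ge_border_distance:
  assumes "k \<le> border_distance T"
  shows "leftmost_path_ge k T"
proof (rule ccontr)
  assume "\<not> leftmost_path_ge k T"
  then obtain j where j: "j < k" "replicate j 0 \<in> leaves T"
    using leftmost_leaf by blast
  have "finite (leaves T)"
    using finite_vertices[of T] by (simp add: leaves_def)
  then have "border_distance T \<le> graph_distance T [] (replicate j 0)"
    unfolding border_distance_def using j by (intro Min_le) auto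
  also have "\<dots> \<le> j"
    using j graph_distance_root_le[of "replicate j 0" T] by (simp add: leaves_def)
  finally show False using assms j by simp
qed

section \<open>Forests and one step of the depth-first exploration\<close>

definition forests :: "nat \<Rightarrow> nat \<Rightarrow> plane_tree list set" where
  "forests m h = {ts. length ts = h \<and> (\<Sum>t\<leftarrow>ts. card (vertices t)) = m}"

text \<open>The exploration of a tree passes through forests; trees are the case
  \<open>h = 1\<close>. For \<open>h = 0\<close> the value \<open>hd []\<close> is unspecified, so
  it matters that \<open>h > 0\<close> or \<open>k = 0\<close> wherever this is used.\<close>

definition deep_weight :: "(nat \<Rightarrow> real) \<Rightarrow> nat \<Rightarrow> nat \<Rightarrow> nat \<Rightarrow> real" where
  "deep_weight w k m h =
    (\<Sum>ts\<in>forests m h. if leftmost_path_ge k (hd ts) then \<Prod>t\<leftarrow>ts. tree_weight w t else 0)"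

lemma finite_forests: "finite (forests m h)"
proof -
  have "finite (\<Union>i\<le>m. plane_trees i)"
    by (simp add: finite_plane_trees)
  moreover have "forests m h \<subseteq> {ts. set ts \<subseteq> (\<Union>i\<le>m. plane_trees i) \<and> length ts = h}"
    by (auto simp: forests_def plane_trees_def intro!: member_le_sum_list)
  ultimately show ?thesis
    using finite_lists_length_eq finite_subset by blast
qed

lemma length_le_forest_size: "length ts \<le> (\<Sum>t\<leftarrow>ts. card (vertices t))"
  using length_subtrees_less[of ts] by (simp add: card_vertices_Node)

text \<open>Deleting the root of the first tree of a forest leaves a forest again.\<close>

lemma sum_forests_Suc:
  "(\<Sum>F\<in>forests (Suc m) (Suc h). f F) =
   (\<Sum>d\<le>m. \<Sum>ts\<in>forests m (h + d). f (Node (take d ts) # drop d ts))"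
proof -
  have "(\<Sum>d\<le>m. \<Sum>ts\<in>forests m (h + d). f (Node (take d ts) # drop d ts)) =
      (\<Sum>(d, ts)\<in>Sigma {..m} (\<lambda>d. forests m (h + d)). f (Node (take d ts) # drop d ts))"
    by (rule sum.Sigma) (auto simp: finite_forests)
  \<comment> \<open>\<open>d\<close> is the outdegree of the deleted root and records how many
    leading trees of \<open>ts\<close> hang below it, so that the forest can be restored.\<close>
  also have "\<dots> = (\<Sum>F\<in>forests (Suc m) (Suc h). f F)"
  proof (rule sum.reindex_bij_witness[where
        j = "\<lambda>(d, ts). Node (take d ts) # drop d ts" and
        i = "\<lambda>F. (length (subtrees (hd F)), subtrees (hd F) @ tl F)"])
    fix F assume F: "F \<in> forests (Suc m) (Suc h)"
    then obtain t rest where "F = t # rest"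
      by (auto simp: forests_def length_Suc_conv)
    moreover obtain us where "t = Node us"
      by (cases t)
    ultimately have F_eq: "F = Node us # rest" by simp
    then show "(length (subtrees (hd F)), subtrees (hd F) @ tl F)
        \<in> Sigma {..m} (\<lambda>d. forests m (h + d))"
      using F length_le_forest_size[of us] by (auto simp: forests_def card_vertices_Node)
    show "(case (length (subtrees (hd F)), subtrees (hd F) @ tl F) of
        (d, ts) \<Rightarrow> Node (take d ts) # drop d ts) = F"
      using F_eq by simp
  next
    fix a assume "a \<in> Sigma {..m} (\<lambda>d. forests m (h + d))"
    then obtain d ts where a: "a = (d, ts)" "d \<le> m" "ts \<in> forests m (h + d)"
      by auto
    have "(\<Sum>t\<leftarrow>take d ts. card (vertices t)) + (\<Sum>t\<leftarrow>drop d ts. card (vertices t)) =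
        (\<Sum>t\<leftarrow>ts. card (vertices t))"
      by (metis append_take_drop_id map_append sum_list.append)
    then show "(case a of (d, ts) \<Rightarrow> Node (take d ts) # drop d ts) \<in> forests (Suc m) (Suc h)"
      using a by (auto simp: forests_def card_vertices_Node)
    show "(length (subtrees (hd (case a of (d, ts) \<Rightarrow> Node (take d ts) # drop d ts))),
        subtrees (hd (case a of (d, ts) \<Rightarrow> Node (take d ts) # drop d ts)) @
        tl (case a of (d, ts) \<Rightarrow> Node (take d ts) # drop d ts)) = a"
      using a by (auto simp: forests_def)
  qed auto
  finally show ?thesis by simp
qed

lemma prod_weight_Node_take_drop:
  assumes "length ts = h + d"
  shows "(\<Prod>t\<leftarrow>Node (take d ts) # drop d ts. tree_weight w t) = w d * (\<Prod>t\<leftarrow>ts. tree_weight w t)"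
proof -
  have "(\<Prod>t\<leftarrow>ts. tree_weight w t) =
      (\<Prod>t\<leftarrow>take d ts. tree_weight w t) * (\<Prod>t\<leftarrow>drop d ts. tree_weight w t)"
    by (metis append_take_drop_id map_append prod_list.append)
  then show ?thesis using assms by (simp add: tree_weight_Node)
qed

lemma deep_weight_0_Suc:
  "deep_weight w 0 (Suc m) (Suc h) = (\<Sum>d\<le>m. w d * deep_weight w 0 m (h + d))"
  unfolding deep_weight_def sum_forests_Suc sum_distrib_left leftmost_path_ge.simps if_True
  by (intro sum.cong[OF refl] prod_weight_Node_take_drop) (simp add: forests_def)

text \<open>The deleted root must have a child, so its outdegree is \<open>Suc e\<close> and the
  number of trees does not drop; its first child heads the new forest and inherits the condition for
  \<open>k\<close>.\<close>

lemma deep_weight_Suc_Suc: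
  "deep_weight w (Suc k) (Suc m) (Suc h) =
   (\<Sum>e<m. w (Suc e) * deep_weight w k m (Suc h + e))"
proof -
  have "deep_weight w (Suc k) (Suc m) (Suc h) =
      (\<Sum>d\<le>m. if d = 0 then 0 else w d * deep_weight w k m (h + d))"
    unfolding deep_weight_def sum_forests_Suc
  proof (rule sum.cong[OF refl])
    fix d
    have "(if leftmost_path_ge (Suc k) (hd (Node (take d ts) # drop d ts))
        then \<Prod>t\<leftarrow>Node (take d ts) # drop d ts. tree_weight w t else 0) =
      w d * (if leftmost_path_ge k (hd ts) then \<Prod>t\<leftarrow>ts. tree_weight w t else 0)"
      if "ts \<in> forests m (h + d)" "d \<noteq> 0" for ts
    proof -
      have len: "length ts = h + d"
        using that by (simp add: forests_def)
      then have "ts \<noteq> []" using that by auto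
      then show ?thesis
        unfolding prod_weight_Node_take_drop[OF len] using that(2) by simp
    qed
    then show "(\<Sum>ts\<in>forests m (h + d).
        if leftmost_path_ge (Suc k) (hd (Node (take d ts) # drop d ts))
        then \<Prod>t\<leftarrow>Node (take d ts) # drop d ts. tree_weight w t else 0) =
      (if d = 0 then 0 else w d * (\<Sum>ts\<in>forests m (h + d).
        if leftmost_path_ge k (hd ts) then \<Prod>t\<leftarrow>ts. tree_weight w t else 0))"
      by (cases "d = 0") (simp_all add: sum_distrib_left del: list.map cong: sum.cong)
  qed
  also have "\<dots> = (\<Sum>e<m. w (Suc e) * deep_weight w k m (Suc h + e))"
    by (simp add: sum.atMost_shift)
  finally show ?thesis .
qed

lemma forests_empty: "m < h \<Longrightarrow> forests m h = {}"
  using length_le_forest_size by (auto simp: forests_def simp flip: not_le)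

text \<open>Each of the first \<open>k\<close> deletions removes a vertex without lowering the
  number of trees, so in the end there would be fewer vertices than trees.\<close>

lemma deep_weight_eq_0:
  assumes "h > 0" and "m < h + k"
  shows "deep_weight w k m h = 0"
  using assms
proof (induction k arbitrary: m h)
  case 0
  then show ?case by (simp add: deep_weight_def forests_empty)
next
  case (Suc k)
  show ?case
  proof (cases m)
    case 0
    with Suc.prems show ?thesis by (simp add: deep_weight_def forests_empty)
  next
    case (Suc m')
    obtain h' where "h = Suc h'" using Suc.prems(1) by (cases h) auto
    with Suc Suc.prems Suc.IH show ?thesis by (simp add: deep_weight_Suc_Suc)
  qed
qed

section \<open>Coefficient formulas for forests and trees\<close>

lemma fps_X_mult_deriv_nth:
  fixes F :: "'a::comm_ring_1 fps"
  shows "(fps_X * fps_deriv F) $ n = of_nat n * F $ n"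
  by (cases n) simp_all

lemma sum_add_index_mult_fps_nth:
  fixes a :: "nat \<Rightarrow> real"
  shows "(\<Sum>d\<le>r. a d * ((c + real d) * G $ (r - d))) =
    ((fps_const c * Abs_fps a + fps_X * fps_deriv (Abs_fps a)) * G) $ r"
  unfolding fps_mult_nth[of _ G] atLeast0AtMost
    fps_add_nth fps_X_mult_deriv_nth fps_mult_left_const_nth fps_nth_Abs_fps
  by (intro sum.cong refl) (simp add: algebra_simps)

text \<open>The hitting time theorem (Otter--Dwass formula).\<close>

lemma deep_weight_0_eq:
  assumes "h \<le> m"
  shows "real m * deep_weight w 0 m h = real h * (Abs_fps w ^ m) $ (m - h)"
  using assms
proof (induction m arbitrary: h)
  case (Suc m)
  let ?\<Phi> = "Abs_fps w"
  show ?case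
  proof (cases h)
    case 0
    have "forests (Suc m) 0 = {}" by (auto simp: forests_def)
    with 0 show ?thesis by (simp add: deep_weight_def)
  next
    case h: (Suc h')
    define r where "r = m - h'"
    have r: "m = h' + r" using Suc.prems h by (simp add: r_def)
    show ?thesis
    proof (cases "m = 0")
      case True
      have "forests 0 0 = {[]}" by (auto simp: forests_def)
      with True h Suc.prems show ?thesis
        by (simp add: deep_weight_0_Suc) (simp add: deep_weight_def)
    next
      case False
      \<comment> \<open>The induction hypothesis carries the factor \<open>real m\<close>, which is
        cancelled at the end; hence the separate case \<open>m = 0\<close>.\<close>
      have "real m * deep_weight w 0 (Suc m) h = (\<Sum>d\<le>m. w d * (real m * deep_weight w 0 m (h' + d)))"
        by (simp add: h deep_weight_0_Suc sum_distrib_left mult_ac)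
      also have "\<dots> = (\<Sum>d\<le>r. w d * (real m * deep_weight w 0 m (h' + d)))"
        by (rule sum.mono_neutral_right) (auto simp: r deep_weight_eq_0)
      also have "\<dots> = (\<Sum>d\<le>r. w d * ((real h' + real d) * (?\<Phi> ^ m) $ (r - d)))"
      proof (intro sum.cong refl)
        fix d assume "d \<in> {..r}"
        then show "w d * (real m * deep_weight w 0 m (h' + d)) =
            w d * ((real h' + real d) * (?\<Phi> ^ m) $ (r - d))"
          using Suc.IH[of "h' + d"] by (simp add: r)
      qed
      also have "\<dots> = real h' * (?\<Phi> ^ Suc m) $ r + (fps_X * fps_deriv ?\<Phi> * ?\<Phi> ^ m) $ r"
        unfolding sum_add_index_mult_fps_nth by (simp add: distrib_right mult.assoc)
      finally have 1: "real m * deep_weight w 0 (Suc m) h =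
          real h' * (?\<Phi> ^ Suc m) $ r + (fps_X * fps_deriv ?\<Phi> * ?\<Phi> ^ m) $ r" .
      \<comment> \<open>By the chain rule the derivative term is
        \<open>real r / real (Suc m)\<close> times the coefficient of
        \<open>?\<Phi> ^ Suc m\<close>; as \<open>m = h' + r\<close>, the two terms combine through
        \<open>Suc m * h' + r = m * h\<close>.\<close>
      have "real (Suc m) * (fps_X * fps_deriv ?\<Phi> * ?\<Phi> ^ m) $ r =
          (fps_X * fps_deriv (?\<Phi> ^ Suc m)) $ r"
        unfolding fps_deriv_power fps_mult_left_const_nth[symmetric] diff_Suc_1
        by (simp only: mult_ac)
      then have "real (Suc m) * (fps_X * fps_deriv ?\<Phi> * ?\<Phi> ^ m) $ r = real r * (?\<Phi> ^ Suc m) $ r"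
        by (simp only: fps_X_mult_deriv_nth)
      with 1 have "real m * (real (Suc m) * deep_weight w 0 (Suc m) h) =
          (real (Suc m) * real h' + real r) * (?\<Phi> ^ Suc m) $ r"
        by (simp only: distrib_left distrib_right mult.assoc mult.left_commute[of "real m"])
      also have "\<dots> = real m * (real h * (?\<Phi> ^ Suc m) $ r)"
        by (simp add: r h algebra_simps)
      finally show ?thesis using False by (simp add: h r_def)
    qed
  qed
qed simp

text \<open>After \<open>k\<close> nonzero outdegrees \<open>Suc e\<close> whose \<open>e\<close>
  sum to \<open>t\<close>, there remain \<open>m\<close> vertices in \<open>h + t\<close> trees, to
  which the hitting time theorem applies. Summed over \<open>t\<close>, the factor
  \<open>h + t\<close> turns \<open>X ^ k\<close> into
  \<open>fps_const (real h) * X ^ k + fps_X * fps_deriv (X ^ k)\<close>.\<close>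

lemma deep_weight_eq:
  fixes w :: "nat \<Rightarrow> real"
  defines "\<Phi> \<equiv> Abs_fps w" and "X \<equiv> Abs_fps (\<lambda>e. w (Suc e))"
  assumes "0 < h" and "h \<le> m"
  shows "real m * deep_weight w k (m + k) h =
    ((fps_const (real h) * X ^ k + fps_X * fps_deriv (X ^ k)) * \<Phi> ^ m) $ (m - h)"
  using assms(3,4)
proof (induction k arbitrary: h)
  case 0
  then show ?case by (simp add: deep_weight_0_eq \<Phi>_def)
next
  case (Suc k)
  define r where "r = m - h"
  have r: "m = h + r" using Suc.prems by (simp add: r_def)
  obtain h' where h': "h = Suc h'" using Suc.prems by (cases h) auto
  have "real m * deep_weight w (Suc k) (m + Suc k) h =
      (\<Sum>e<m + k. w (Suc e) * (real m * deep_weight w k (m + k) (h + e)))"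
    by (simp add: h' deep_weight_Suc_Suc sum_distrib_left mult_ac)
  also have "\<dots> = (\<Sum>e\<le>r. w (Suc e) * (real m * deep_weight w k (m + k) (h + e)))"
    using Suc.prems by (intro sum.mono_neutral_right) (auto simp: r deep_weight_eq_0)
  also have "\<dots> = (\<Sum>e\<le>r. w (Suc e) * ((real h + real e) * (X ^ k * \<Phi> ^ m) $ (r - e)) +
      w (Suc e) * (fps_X * fps_deriv (X ^ k) * \<Phi> ^ m) $ (r - e))"
  proof (intro sum.cong refl)
    fix e assume "e \<in> {..r}"
    then show "w (Suc e) * (real m * deep_weight w k (m + k) (h + e)) =
        w (Suc e) * ((real h + real e) * (X ^ k * \<Phi> ^ m) $ (r - e)) +
        w (Suc e) * (fps_X * fps_deriv (X ^ k) * \<Phi> ^ m) $ (r - e)"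
      using Suc.IH[of "h + e"] Suc.prems by (simp add: r distrib_right distrib_left mult.assoc)
  qed
  also have "\<dots> = ((fps_const (real h) * X + fps_X * fps_deriv X) * (X ^ k * \<Phi> ^ m)) $ r +
      (X * (fps_X * fps_deriv (X ^ k) * \<Phi> ^ m)) $ r"
    unfolding sum.distrib sum_add_index_mult_fps_nth X_def[symmetric]
    unfolding fps_mult_nth[of X] atLeast0AtMost by (simp add: X_def)
  \<comment> \<open>The Leibniz rule merges the factor \<open>e\<close> of the new outdegree with
    the derivative coming from the other \<open>k\<close>.\<close>
  also have "\<dots> = ((fps_const (real h) * X ^ Suc k + fps_X * fps_deriv (X ^ Suc k)) * \<Phi> ^ m) $ r"
    unfolding fps_add_nth[symmetric]
    by (rule arg_cong[where f = "\<lambda>F. F $ r"]) (simp add: algebra_simps del: fps_deriv_power)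
  finally show ?case by (simp only: r_def)
qed

text \<open>
  \<open>n\<close> times the total weight of the trees with \<open>n\<close> vertices and \<open>s + 1\<close> leaves. Removing a child from
  each internal vertex leaves \<open>s\<close> children in total, hence the coefficient of index \<open>s\<close> of the
  shifted series.
\<close>

definition leaf_weight :: "(nat \<Rightarrow> real) \<Rightarrow> nat \<Rightarrow> nat \<Rightarrow> real" where
  "leaf_weight w n s =
    real (n choose Suc s) * w 0 ^ Suc s * (Abs_fps (\<lambda>e. w (Suc e)) ^ (n - Suc s)) $ s"

text \<open>Expanding \<open>Abs_fps w ^ m\<close> by the binomial theorem sorts the trees by their
  number \<open>Suc s\<close> of leaves. The first \<open>k\<close> vertices are internal, so the
  leaves are placed among the other \<open>m\<close>.\<close>

lemma deep_weight_tree_eq: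
  fixes w :: "nat \<Rightarrow> real"
  defines "X \<equiv> Abs_fps (\<lambda>e. w (Suc e))"
  assumes "m > 0"
  shows "real m * deep_weight w k (m + k) 1 =
    (\<Sum>s<m. real (m choose Suc s) * w 0 ^ Suc s * (X ^ (m + k - Suc s)) $ s *
      (1 + real k * real s / real (m + k - Suc s)))"
proof -
  let ?F = "X ^ k + fps_X * fps_deriv (X ^ k)"
  have \<Phi>: "Abs_fps w = fps_const (w 0) + fps_X * X"
    by (rule fps_ext) (simp add: X_def)
  \<comment> \<open>\<open>fps_deriv (X ^ k) * X ^ p\<close> is the fraction
    \<open>k / (p + k)\<close> of \<open>fps_deriv (X ^ (p + k))\<close>, which gives the correction
    factor.\<close>
  have coeff: "(?F * X ^ p) $ s = (X ^ (p + k)) $ s * (1 + real k * real s / real (p + k))" for p s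
  proof (cases "p + k = 0")
    case False
    have "real (p + k) * (fps_X * fps_deriv (X ^ k) * X ^ p) $ s =
        real k * (fps_X * fps_deriv (X ^ (p + k))) $ s"
    proof (cases k)
      case (Suc k')
      show ?thesis
        unfolding fps_deriv_power fps_mult_left_const_nth[symmetric]
        by (rule arg_cong[where f = "\<lambda>F. F $ s"]) (simp add: Suc power_add mult_ac)
    qed simp
    then have "(fps_X * fps_deriv (X ^ k) * X ^ p) $ s =
        (X ^ (p + k)) $ s * (real k * real s / real (p + k))"
      using False unfolding fps_X_mult_deriv_nth by (simp add: field_simps del: of_nat_add)
    then show ?thesis
      by (simp add: distrib_right distrib_left power_add mult.commute[of "X ^ k"])
  qed simp
  have "real m * deep_weight w k (m + k) 1 = (?F * Abs_fps w ^ m) $ (m - 1)"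
    using deep_weight_eq[of 1 m w k] assms by simp
  also have "Abs_fps w ^ m =
      (\<Sum>l\<le>m. fps_const (real (m choose l) * w 0 ^ l) * (fps_X ^ (m - l) * X ^ (m - l)))"
    unfolding \<Phi> binomial_ring
    by (simp add: power_mult_distrib fps_const_power mult_ac flip: fps_const_mult fps_of_nat)
  also have "(?F * \<dots>) $ (m - 1) =
      (\<Sum>l\<le>m. (fps_const (real (m choose l) * w 0 ^ l) * (fps_X ^ (m - l) * (?F * X ^ (m - l)))) $ (m - 1))"
    unfolding sum_distrib_left fps_sum_nth by (simp only: mult_ac)
  \<comment> \<open>The term without leaves vanishes, since a multiple of \<open>fps_X ^ m\<close>
    has coefficient 0 at \<open>m - 1\<close>; for \<open>l > 0\<close> the index drops to
    \<open>l - 1\<close>.\<close>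
  also have "\<dots> = (\<Sum>l\<le>m. if l = 0 then 0 else
      real (m choose l) * w 0 ^ l * (?F * X ^ (m - l)) $ (l - 1))"
    unfolding fps_mult_left_const_nth fps_X_power_mult_nth
    using assms by (intro sum.cong refl) auto
  also have "\<dots> = (\<Sum>s<m. real (m choose Suc s) * w 0 ^ Suc s * (?F * X ^ (m - Suc s)) $ s)"
    by (simp add: sum.atMost_shift)
  also have "\<dots> = (\<Sum>s<m. real (m choose Suc s) * w 0 ^ Suc s * (X ^ (m + k - Suc s)) $ s *
      (1 + real k * real s / real (m + k - Suc s)))"
    unfolding coeff by (intro sum.cong refl) (simp add: Suc_le_eq)
  finally show ?thesis .
qed

section \<open>Bounds for power series coefficients and binomials\<close>

lemma fps_power_nth_nonneg:
  fixes F :: "real fps"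
  assumes "\<And>i. F $ i \<ge> 0"
  shows "(F ^ n) $ i \<ge> 0"
proof (induction n arbitrary: i)
  case (Suc n)
  then show ?case using assms by (simp add: fps_mult_nth sum_nonneg)
qed (simp add: fps_one_nth)

text \<open>Words of length \<open>m\<close> with sum \<open>s\<close> contain at least \<open>m - s\<close> zeros.\<close>

lemma fps_power_nth_le:
  fixes F :: "real fps"
  assumes "\<And>i. F $ i \<ge> 0"
  shows "(real m - real s) * (F ^ m) $ s \<le> real m * F $ 0 * (F ^ (m - 1)) $ s"
proof (cases m)
  case 0
  then show ?thesis by (simp add: fps_one_nth)
next
  case (Suc m')
  have "(F ^ m) $ s - F $ 0 * (F ^ m') $ s = (\<Sum>d\<in>{..s} - {0}. F $ d * (F ^ m') $ (s - d))"
    by (simp add: Suc fps_mult_nth atLeast0AtMost sum_diff1)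
  also have "\<dots> \<le> (\<Sum>d\<in>{..s} - {0}. real d * F $ d * (F ^ m') $ (s - d))"
  proof (intro sum_mono mult_right_mono)
    fix d assume "d \<in> {..s} - {0}"
    then show "F $ d \<le> real d * F $ d"
      using mult_right_mono[of 1 "real d" "F $ d"] assms by simp
  qed (rule fps_power_nth_nonneg[OF assms])
  also have "\<dots> = (\<Sum>d\<le>s. real d * F $ d * (F ^ m') $ (s - d))"
    by (rule sum.mono_neutral_left) auto
  also have "\<dots> = (fps_X * fps_deriv F * F ^ m') $ s"
    unfolding fps_mult_nth[of _ "F ^ m'"] fps_X_mult_deriv_nth atLeast0AtMost ..
  finally have "real m * ((F ^ m) $ s - F $ 0 * (F ^ m') $ s) \<le>
      real m * (fps_X * fps_deriv F * F ^ m') $ s"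
    by (intro mult_left_mono) auto
  \<comment> \<open>By symmetry all \<open>m\<close> positions contribute alike, so \<open>m\<close>
    times the first letter amounts to the whole sum \<open>s\<close>; for series this is the
    derivative of a power.\<close>
  also have "\<dots> = (fps_X * fps_deriv (F ^ m)) $ s"
    unfolding fps_deriv_power fps_mult_left_const_nth[symmetric]
    by (rule arg_cong[where f = "\<lambda>F. F $ s"]) (simp add: Suc mult_ac)
  also have "\<dots> = real s * (F ^ m) $ s"
    by (rule fps_X_mult_deriv_nth)
  finally show ?thesis by (simp add: Suc algebra_simps)
qed

text \<open>As long as the exponent is at least \<open>2 * s\<close>, at least half of the letters
  are zero, so \<open>fps_power_nth_le\<close> removes a letter at the cost of a factor
  \<open>2 * F $ 0\<close>.\<close>

lemma fps_power_add_nth_le: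
  fixes F :: "real fps"
  assumes nonneg: "\<And>i. F $ i \<ge> 0" and "2 * s \<le> p + 1"
  shows "(F ^ (p + j)) $ s \<le> (2 * F $ 0) ^ j * (F ^ p) $ s"
proof (induction j)
  case (Suc j)
  define m where "m = p + Suc j"
  have "real m / 2 * (F ^ m) $ s \<le> (real m - real s) * (F ^ m) $ s"
    using assms(2) fps_power_nth_nonneg[OF nonneg, of m s] by (intro mult_right_mono) (simp_all add: m_def)
  also have "\<dots> \<le> real m * F $ 0 * (F ^ (m - 1)) $ s"
    by (rule fps_power_nth_le[OF nonneg])
  finally have "real m * (F ^ m) $ s \<le> real m * (2 * F $ 0 * (F ^ (m - 1)) $ s)"
    by simp
  then have "(F ^ m) $ s \<le> 2 * F $ 0 * (F ^ (m - 1)) $ s"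
    by (rule mult_left_le_imp_le) (simp add: m_def)
  also have "\<dots> \<le> 2 * F $ 0 * ((2 * F $ 0) ^ j * (F ^ p) $ s)"
    using Suc nonneg by (intro mult_left_mono) (auto simp: m_def)
  finally show ?case by (simp add: m_def mult_ac)
qed simp

text \<open>The quotient of the two binomials is \<open>(n - l) / Suc l\<close>, which is at least
  \<open>E\<close>.\<close>

lemma binomial_Suc_ge:
  assumes "Suc E * Suc l \<le> n"
  shows "E * (n choose l) \<le> n choose Suc l"
proof -
  have "Suc l * E \<le> n - l"
    using assms by (simp add: algebra_simps)
  then have "Suc l * (E * (n choose l)) \<le> (n - l) * (n choose l)"
    by (metis mult.assoc mult_le_mono1)
  also have "\<dots> = Suc l * (n choose Suc l)"
    by (metis binomial_absorb_comp binomial_absorption mult.commute)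
  finally show ?thesis by (simp only: Suc_mult_le_cancel1)
qed

text \<open>One step already gains the factor \<open>E\<close>; the others only have to avoid a
  loss.\<close>

lemma binomial_add_ge:
  assumes "E > 0" "j > 0" "Suc E * (l + j) \<le> n"
  shows "E * (n choose l) \<le> n choose (l + j)"
  using assms(2,3)
proof (induction j rule: nat_induct_non_zero)
  case 1
  then show ?case using binomial_Suc_ge[of E l n] by simp
next
  case (Suc j)
  have "E * (n choose l) \<le> n choose (l + j)"
    using Suc by (simp add: algebra_simps)
  also have "\<dots> \<le> E * (n choose (l + j))"
    using assms(1) by simp
  also have "\<dots> \<le> n choose (l + Suc j)"
    using binomial_Suc_ge[of E "l + j" n] Suc.prems by simp
  finally show ?case .
qed

text \<open>For \<open>l \<le> M\<close>, lowering the upper index from \<open>M\<close> to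
  \<open>M - 1\<close> multiplies the binomial by \<open>1 - l / M\<close>, and
  \<open>M \<le> n\<close> here.\<close>

lemma binomial_le_add:
  assumes "m + k \<le> n" "l \<le> n"
  shows "real (m choose l) \<le> real ((m + k) choose l) * (1 - real l / real n) ^ k"
  using assms(1)
proof (induction k)
  case (Suc k)
  have step: "real ((m + k) choose l) \<le> real ((m + Suc k) choose l) * (1 - real l / real n)"
  proof (cases "l \<le> m + Suc k")
    case True
    have "(m + Suc k - l) * ((m + Suc k) choose l) = (m + Suc k) * ((m + k) choose l)"
      using binomial_absorb_comp[of "m + Suc k" l] by simp
    then have "real (m + Suc k - l) * real ((m + Suc k) choose l) = real (m + Suc k) * real ((m + k) choose l)"
      by (metis of_nat_mult)
    moreover have "1 - real l / real (m + Suc k) = real (m + Suc k - l) / real (m + Suc k)"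
      using True by (subst of_nat_diff) (auto simp: diff_divide_distrib)
    ultimately have "real ((m + k) choose l) = real ((m + Suc k) choose l) * (1 - real l / real (m + Suc k))"
      by (simp add: field_simps del: of_nat_diff of_nat_Suc of_nat_add)
    also have "\<dots> \<le> real ((m + Suc k) choose l) * (1 - real l / real n)"
      using Suc.prems by (intro mult_left_mono diff_left_mono divide_left_mono) auto
    finally show ?thesis .
  qed (simp add: binomial_eq_0)
  have "real (m choose l) \<le> real ((m + k) choose l) * (1 - real l / real n) ^ k"
    using Suc by simp
  also have "\<dots> \<le> (real ((m + Suc k) choose l) * (1 - real l / real n)) * (1 - real l / real n) ^ k"
    using step assms(2) by (intro mult_right_mono zero_le_power) (auto simp: divide_le_eq_1)
  finally show ?case by (simp add: mult_ac)
qed simp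

section \<open>The weight of trees with few leaves\<close>

lemma leaf_weight_nonneg:
  assumes "weight_sequence w"
  shows "leaf_weight w n s \<ge> 0"
  using assms unfolding leaf_weight_def weight_sequence_def
  by (intro mult_nonneg_nonneg fps_power_nth_nonneg) auto

text \<open>Adding \<open>j\<close> leaves gains a factor \<open>E\<close> from the binomial,
  arbitrarily large for large \<open>D\<close>, whereas the other factors lose at most a
  constant.\<close>

lemma leaf_weight_doubling:
  assumes w: "weight_sequence w"
  obtains D j where "D > 0" "j > 0"
    "\<And>n s. D * (Suc s + j) \<le> n \<Longrightarrow> 2 * leaf_weight w n s \<le> leaf_weight w n (s + j)"
proof -
  define X where "X = Abs_fps (\<lambda>e. w (Suc e))"
  have X: "X $ i \<ge> 0" for i
    using w by (simp add: X_def weight_sequence_def)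
  have w0: "w 0 > 0" using w by (simp add: weight_sequence_def)
  obtain k where "k \<ge> 2" "w k > 0" using w by (auto simp: weight_sequence_def)
  then obtain j where j: "j > 0" "w (Suc j) > 0"
    by (metis One_nat_def Suc_le_D Suc_le_lessD Suc_1 Suc_le_mono)
  \<comment> \<open>\<open>a\<close> weighs the inserted vertex of outdegree \<open>Suc j\<close>
    and its \<open>j\<close> leaves; \<open>c\<close> is the price from
    \<open>fps_power_add_nth_le\<close> for the \<open>Suc j\<close> vertices that they
    replace.\<close>
  define a where "a = w 0 ^ j * w (Suc j)"
  define c where "c = (2 * X $ 0) ^ Suc j"
  have a: "a > 0" using w0 j by (simp add: a_def)
  have c: "c \<ge> 0" using X by (simp add: c_def)
  \<comment> \<open>\<open>E\<close> has to outweigh \<open>2 * c / a\<close>; as \<open>c\<close>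
    may be 0, \<open>c + 1\<close> is used, which can be cancelled. \<open>E \<ge> 3\<close> leaves
    enough internal vertices.\<close>
  obtain E0 where E0: "2 * (c + 1) / a < real E0" using reals_Archimedean2 by blast
  define E where "E = max 3 E0"
  have E: "E \<ge> 3" "2 * (c + 1) \<le> real E * a"
  proof -
    have "2 * (c + 1) / a \<le> real E" using E0 by (simp add: E_def)
    then show "2 * (c + 1) \<le> real E * a" using a by (simp add: divide_le_eq)
  qed (simp add: E_def)
  have "2 * leaf_weight w n s \<le> leaf_weight w n (s + j)" if n: "Suc E * (Suc s + j) \<le> n" for n s
  proof -
    \<comment> \<open>There are \<open>p + Suc j\<close> internal vertices before the exchange and
      \<open>Suc p\<close> after it.\<close>
    define p where "p = n - Suc s - Suc j"
    have "4 * (Suc s + j) \<le> Suc E * (Suc s + j)"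
      using E by (intro mult_le_mono1) simp
    then have n4: "4 * (Suc s + j) \<le> n" using n by simp
    then have p: "n - Suc s = p + Suc j" "n - Suc (s + j) = Suc p" "2 * s \<le> p + 1"
      using j by (auto simp: p_def)
    \<comment> \<open>Only the words with first letter \<open>j\<close> are kept.\<close>
    have "w (Suc j) * (X ^ p) $ s \<le> (\<Sum>i\<le>s + j. X $ i * (X ^ p) $ (s + j - i))"
      using X fps_power_nth_nonneg[OF X]
        member_le_sum[of j "{..s + j}" "\<lambda>i. X $ i * (X ^ p) $ (s + j - i)"]
      by (simp add: X_def)
    then have grow: "w (Suc j) * (X ^ p) $ s \<le> (X ^ Suc p) $ (s + j)"
      by (simp add: fps_mult_nth atLeast0AtMost)
    have shrink: "(X ^ (p + Suc j)) $ s \<le> c * (X ^ p) $ s"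
      unfolding c_def using fps_power_add_nth_le[of X s p "Suc j", OF X p(3)] .
    have "E * (n choose Suc s) \<le> n choose (Suc s + j)"
      using E j n by (intro binomial_add_ge) auto
    then have choose: "real E * real (n choose Suc s) \<le> real (n choose Suc (s + j))"
      by (metis add_Suc of_nat_le_iff of_nat_mult)
    have "real E * a * leaf_weight w n s =
        (real E * real (n choose Suc s)) * (w 0 ^ Suc (s + j) * (w (Suc j) * (X ^ (p + Suc j)) $ s))"
      unfolding leaf_weight_def X_def[symmetric] p a_def by (simp add: power_add mult_ac)
    also have "\<dots> \<le> real (n choose Suc (s + j)) *
        (w 0 ^ Suc (s + j) * (w (Suc j) * (c * (X ^ p) $ s)))"
      using choose shrink w0 j fps_power_nth_nonneg[OF X]
      by (intro mult_mono mult_left_mono mult_nonneg_nonneg) (auto simp del: power_Suc)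
    also have "\<dots> = c * (real (n choose Suc (s + j)) *
        (w 0 ^ Suc (s + j) * (w (Suc j) * (X ^ p) $ s)))"
      by (simp add: mult_ac)
    also have "\<dots> \<le> c * (real (n choose Suc (s + j)) * (w 0 ^ Suc (s + j) * (X ^ Suc p) $ (s + j)))"
      using grow c w0 by (intro mult_left_mono) auto
    also have "\<dots> = c * leaf_weight w n (s + j)"
      unfolding leaf_weight_def X_def[symmetric] p by (simp add: mult_ac)
    also have "\<dots> \<le> (c + 1) * leaf_weight w n (s + j)"
      using leaf_weight_nonneg[OF w] by (intro mult_right_mono) auto
    finally have "real E * a * leaf_weight w n s \<le> (c + 1) * leaf_weight w n (s + j)" .
    moreover have "2 * (c + 1) * leaf_weight w n s \<le> real E * a * leaf_weight w n s"
      using E leaf_weight_nonneg[OF w] by (intro mult_right_mono) auto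
    ultimately have "(c + 1) * (2 * leaf_weight w n s) \<le> (c + 1) * leaf_weight w n (s + j)"
      by (simp add: algebra_simps)
    then show ?thesis by (rule mult_left_le_imp_le) (use c in simp)
  qed
  with j show thesis using that[of "Suc E" j] by blast
qed

text \<open>Iterated doubling moves the indices with few leaves injectively to larger ones. The
  bound on \<open>Suc s\<close> uses up half of the allowance \<open>n / D\<close>, and the
  \<open>b\<close> shifts by \<open>j\<close> the other half.\<close>

lemma sum_leaf_weight_few_leaves:
  assumes w: "weight_sequence w" and D: "D > 0" and "j > 0"
    and doubling: "\<And>n s. D * (Suc s + j) \<le> n \<Longrightarrow> 2 * leaf_weight w n s \<le> leaf_weight w n (s + j)"
  shows "(\<Sum>s | 2 * D * Suc s \<le> n. leaf_weight w n s) \<le>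
    (1 / 2) ^ (n div (2 * D * j)) * (\<Sum>s<n. leaf_weight w n s)"
proof -
  define b where "b = n div (2 * D * j)"
  define A where "A = {s. 2 * D * Suc s \<le> n}"
  have iterate: "2 ^ i * leaf_weight w n s \<le> leaf_weight w n (s + i * j)"
    if "D * (Suc s + i * j) \<le> n" for i s
    using that
  proof (induction i)
    case (Suc i)
    have "2 ^ i * leaf_weight w n s \<le> leaf_weight w n (s + i * j)"
      using Suc by (simp add: algebra_simps)
    moreover have "2 * leaf_weight w n (s + i * j) \<le> leaf_weight w n (s + i * j + j)"
      using Suc.prems by (intro doubling) (simp add: algebra_simps)
    ultimately show ?case by (simp add: add_ac)
  qed simp
  have b: "2 * D * j * b \<le> n" by (simp add: b_def)
  have shift: "D * (Suc s + b * j) \<le> n" if "s \<in> A" for s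
    using that b unfolding A_def by (simp add: algebra_simps)
  have less: "s + b * j < n" if "s \<in> A" for s
  proof -
    have "Suc s + b * j \<le> D * (Suc s + b * j)" using D by (cases D) auto
    with shift[OF that] show ?thesis by simp
  qed
  have "2 ^ b * (\<Sum>s\<in>A. leaf_weight w n s) \<le> (\<Sum>s\<in>A. leaf_weight w n (s + b * j))"
    unfolding sum_distrib_left by (intro sum_mono iterate shift)
  also have "\<dots> = (\<Sum>s\<in>(\<lambda>s. s + b * j) ` A. leaf_weight w n s)"
    by (subst sum.reindex) auto
  also have "\<dots> \<le> (\<Sum>s<n. leaf_weight w n s)"
    using less leaf_weight_nonneg[OF w] by (intro sum_mono2) auto
  finally show ?thesis
    unfolding A_def[symmetric] b_def[symmetric] by (simp add: field_simps)
qed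

section \<open>Deep trees compared with all trees\<close>

text \<open>Against \<open>n choose Suc s\<close>, the binomial \<open>m choose Suc s\<close> brings
  \<open>Suc k\<close> factors \<open>x\<close>, the proportion of internal vertices. One of them
  cancels the denominator of the correction factor, leaving at most \<open>k + 2\<close>.\<close>

lemma deep_weight_tree_le:
  assumes w: "weight_sequence w" and m: "m > 0" and n: "n = m + Suc k"
  shows "real m * deep_weight w (Suc k) n 1 \<le>
    real (k + 2) * (\<Sum>s<n. leaf_weight w n s * (1 - real (Suc s) / real n) ^ k)"
proof -
  define X where "X = Abs_fps (\<lambda>e. w (Suc e))"
  have X: "X $ i \<ge> 0" for i
    using w by (simp add: X_def weight_sequence_def)
  have w0: "w 0 \<ge> 0" using w by (simp add: weight_sequence_def)
  have "real m * deep_weight w (Suc k) n 1 =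
    (\<Sum>s<m. real (m choose Suc s) * w 0 ^ Suc s * (X ^ (n - Suc s)) $ s *
      (1 + real (Suc k) * real s / real (n - Suc s)))"
    using deep_weight_tree_eq[OF m, of w "Suc k"] n by (simp add: X_def)
  also have "\<dots> \<le> (\<Sum>s<m. real (k + 2) * (leaf_weight w n s * (1 - real (Suc s) / real n) ^ k))"
  proof (rule sum_mono)
    fix s assume "s \<in> {..<m}"
    then have s: "Suc s < n" "Suc s \<le> n" using n by auto
    define x where "x = 1 - real (Suc s) / real n"
    have x: "x \<ge> 0" using s by (simp add: x_def)
    have xn: "x = real (n - Suc s) / real n"
      using s by (simp add: x_def of_nat_diff field_simps)
    have "x * (1 + real (Suc k) * real s / real (n - Suc s)) = x + real (Suc k) * (real s / real n)"
      unfolding xn using s by (simp add: field_simps del: of_nat_Suc of_nat_diff)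
    also have "\<dots> \<le> 1 + real (Suc k) * 1"
      using s by (intro add_mono mult_left_mono) (auto simp: x_def)
    finally have h: "x * (1 + real (Suc k) * real s / real (n - Suc s)) \<le> real (k + 2)" by simp
    have "real (m choose Suc s) * w 0 ^ Suc s * (X ^ (n - Suc s)) $ s *
        (1 + real (Suc k) * real s / real (n - Suc s)) \<le>
        (real (n choose Suc s) * x ^ Suc k) * w 0 ^ Suc s * (X ^ (n - Suc s)) $ s *
        (1 + real (Suc k) * real s / real (n - Suc s))"
      using binomial_le_add[of m "Suc k" n "Suc s"] s w0 fps_power_nth_nonneg[OF X]
      by (intro mult_right_mono) (auto simp: n x_def)
    also have "\<dots> = leaf_weight w n s * x ^ k * (x * (1 + real (Suc k) * real s / real (n - Suc s)))"
      unfolding leaf_weight_def X_def[symmetric] by (simp only: power_Suc mult_ac)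
    also have "\<dots> \<le> leaf_weight w n s * x ^ k * real (k + 2)"
      using h x leaf_weight_nonneg[OF w] by (intro mult_left_mono) auto
    finally show "real (m choose Suc s) * w 0 ^ Suc s * (X ^ (n - Suc s)) $ s *
        (1 + real (Suc k) * real s / real (n - Suc s)) \<le>
        real (k + 2) * (leaf_weight w n s * (1 - real (Suc s) / real n) ^ k)"
      by (simp only: x_def mult_ac)
  qed
  also have "\<dots> \<le> (\<Sum>s<n. real (k + 2) * (leaf_weight w n s * (1 - real (Suc s) / real n) ^ k))"
    using n leaf_weight_nonneg[OF w]
    by (intro sum_mono2 mult_nonneg_nonneg zero_le_power) auto
  finally show ?thesis by (simp only: sum_distrib_left)
qed

lemma deep_weight_1:
  "deep_weight w k n 1 = (\<Sum>T\<in>plane_trees n. if leftmost_path_ge k T then tree_weight w T else 0)"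
proof -
  have "forests n 1 = (\<lambda>T. [T]) ` plane_trees n"
    by (auto simp: forests_def plane_trees_def length_Suc_conv)
  moreover have "inj_on (\<lambda>T. [T]) (plane_trees n)" by (simp add: inj_on_def)
  ultimately show ?thesis by (simp add: deep_weight_def sum.reindex cong: if_cong)
qed

text \<open>For \<open>k = 0\<close> the formula of \<open>deep_weight_tree_eq\<close> covers all
  trees, sorted by their number of leaves.\<close>

lemma partition_function_eq:
  assumes "n > 0"
  shows "real n * partition_function w n = (\<Sum>s<n. leaf_weight w n s)"
  using deep_weight_tree_eq[of n w 0] assms deep_weight_1[of w 0 n]
  by (simp add: partition_function_def leaf_weight_def)

lemma partition_function_pos:
  assumes "weight_sequence w" "sg_defined w n"
  shows "partition_function w n > 0"
proof -
  obtain T where "T \<in> plane_trees n" "tree_weight w T > 0"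
    using assms(2) by (auto simp: sg_defined_def)
  then show ?thesis
    unfolding partition_function_def using assms(1)
    by (intro sum_pos2[of _ T] finite_plane_trees)
      (auto simp: tree_weight_def weight_sequence_def intro!: prod_nonneg)
qed

lemma prob_border_distance_le:
  assumes w: "weight_sequence w" and n: "sg_defined w n"
  shows "measure_pmf.prob (simply_generated_tree w n) {T. border_distance T \<ge> k}
    \<le> deep_weight w k n 1 / partition_function w n"
proof -
  let ?p = "simply_generated_tree w n" and ?Z = "partition_function w n"
  let ?A = "{T \<in> plane_trees n. leftmost_path_ge k T}"
  \<comment> \<open>Intersecting with the support leaves a finite set of trees, over which the point
    masses can be summed.\<close>
  have "measure_pmf.prob ?p {T. border_distance T \<ge> k} =
      measure_pmf.prob ?p ({T. border_distance T \<ge> k} \<inter> set_pmf ?p)"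
    by (simp add: measure_Int_set_pmf)
  also have "\<dots> \<le> measure_pmf.prob ?p ?A"
    using leftmost_path_ge_border_distance
    by (intro measure_pmf.finite_measure_mono)
      (auto simp: set_pmf_iff pmf_simply_generated_tree[OF w n] split: if_splits)
  also have "\<dots> = (\<Sum>T\<in>?A. pmf ?p T)"
    by (rule measure_measure_pmf_finite) (simp add: finite_plane_trees)
  also have "\<dots> = (\<Sum>T\<in>?A. tree_weight w T) / ?Z"
    by (simp add: pmf_simply_generated_tree[OF w n] sum_divide_distrib)
  also have "(\<Sum>T\<in>?A. tree_weight w T) = deep_weight w k n 1"
    unfolding deep_weight_1 by (simp add: finite_plane_trees sum.inter_filter)
  finally show ?thesis .
qed

section \<open>Exponential estimates and conclusion\<close>

text \<open>Half of the decay pays for the polynomial, by \<open>y ^ 2 / 2 \<le> exp y\<close> for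
  \<open>y = c * (k + 2)\<close>.\<close>

lemma square_mult_exp_le:
  fixes c :: real
  assumes "c > 0"
  shows "real (k + 2) ^ 2 * exp (- 2 * c * real k) \<le> 2 / c ^ 2 * exp (2 * c) * exp (- c * real k)"
proof -
  have "(c * real (k + 2)) ^ 2 / 2 \<le> exp (c * real (k + 2))"
    using exp_lower_Taylor_quadratic[of "c * real (k + 2)"] assms by (smt (verit) mult_nonneg_nonneg of_nat_0_le_iff)
  then have "real (k + 2) ^ 2 \<le> 2 / c ^ 2 * exp (c * real (k + 2))"
    unfolding power_mult_distrib using assms by (simp add: field_simps del: of_nat_add)
  then have "real (k + 2) ^ 2 * exp (- 2 * c * real k) \<le>
      2 / c ^ 2 * exp (c * real (k + 2)) * exp (- 2 * c * real k)"
    by (intro mult_right_mono) auto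
  also have "\<dots> = 2 / c ^ 2 * exp (2 * c) * exp (- c * real k)"
    by (simp add: algebra_simps flip: exp_add)
  finally show ?thesis .
qed

text \<open>Rounding down in \<open>n div q\<close> loses less than 1 in the exponent, whence the
  factor 2.\<close>

lemma half_power_div_le:
  assumes "q > 0" "k \<le> n"
  shows "(1 / 2 :: real) ^ (n div q) \<le> 2 * exp (- (ln 2 / real q) * real k)"
proof -
  have "n < q * Suc (n div q)"
    using assms(1) by (simp add: dividend_less_times_div)
  then have "real k \<le> real q * real (Suc (n div q))"
    using assms(2) by (metis le_trans less_imp_le of_nat_le_iff of_nat_mult)
  then have "real k / real q \<le> real (n div q) + 1"
    using assms(1) by (simp add: field_simps)
  then have "ln 2 * (real k / real q) \<le> ln 2 * (real (n div q) + 1)"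
    by (intro mult_left_mono) auto
  then have "exp (- (ln 2 * (real (n div q) + 1))) \<le> exp (- (ln 2 * (real k / real q)))"
    by simp
  moreover have "exp (- (ln 2 * (real (n div q) + 1))) = (1 / 2 :: real) ^ (n div q) / 2"
  proof -
    have "exp (ln 2 * (real (n div q) + 1)) = (2 :: real) powr real (Suc (n div q))"
      by (simp add: powr_def algebra_simps)
    also have "\<dots> = 2 ^ Suc (n div q)"
      by (rule powr_realpow) simp
    finally show ?thesis
      unfolding exp_minus by (simp add: power_one_over inverse_eq_divide del: exp_add)
  qed
  ultimately show ?thesis by simp
qed

theorem proposition4p12:
  fixes w :: "nat \<Rightarrow> real"
  assumes "weight_sequence w"
    and "type_I w \<or> type_II w \<or> type_III w"
  shows "\<exists>n0\<ge>1::nat. \<exists>C>0::real. \<exists>c>0::real. \<forall>n\<ge>n0. sg_defined w n \<longrightarrow>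
    (\<forall>k::nat. measure_pmf.prob (simply_generated_tree w n) {T. border_distance T \<ge> k}
       \<le> C * exp (- c * real k))"
proof -
  obtain D j where D: "D > 0" and j: "j > 0" and doubling:
    "\<And>n s. D * (Suc s + j) \<le> n \<Longrightarrow> 2 * leaf_weight w n s \<le> leaf_weight w n (s + j)"
    using leaf_weight_doubling[OF assms(1)] by blast
  \<comment> \<open>\<open>2 * c\<close> is at most the rate \<open>1 / (2 * D)\<close> for many
    leaves and the rate \<open>ln 2 / (2 * D * j)\<close> for few leaves; half of
    \<open>2 * c\<close> is later spent on a quadratic factor.\<close>
  define c where "c = min (1 / (4 * real D)) (ln 2 / real (4 * D * j))"
  \<comment> \<open>1 serves \<open>k = 0\<close>; 6 is 3 times the 2 of
    \<open>square_mult_exp_le\<close>, and \<open>exp (3 * c)\<close> joins its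
    \<open>exp (2 * c)\<close> to the \<open>exp c\<close> lost from \<open>k\<close> to
    \<open>i = k - 1\<close>.\<close>
  define C where "C = max 1 (6 / c ^ 2 * exp (3 * c))"
  have c: "c > 0" using D j by (simp add: c_def)
  have "measure_pmf.prob (simply_generated_tree w n) {T. border_distance T \<ge> k}
      \<le> C * exp (- c * real k)"
    if n: "n \<ge> 1" "sg_defined w n" for n k
  proof (cases k)
    case 0
    have "measure_pmf.prob (simply_generated_tree w n) {T. border_distance T \<ge> k} \<le> 1"
      by (rule measure_pmf.prob_le_1)
    then show ?thesis using 0 by (simp add: C_def)
  next
    case (Suc i)
    let ?Z = "partition_function w n" and ?L = "\<Sum>s<n. leaf_weight w n s"
    have Z: "?Z > 0" using assms(1) n by (rule_tac partition_function_pos)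
    have "deep_weight w k n 1 \<le> C * exp (- c * real k) * ?Z"
    proof (cases "n \<le> k")
      case True
      \<comment> \<open>A leftmost path with \<open>k\<close> edges takes \<open>k + 1\<close>
        vertices.\<close>
      then have "deep_weight w k n 1 = 0" by (intro deep_weight_eq_0) auto
      then show ?thesis using Z by (simp add: C_def)
    next
      case False
      define m where "m = n - k"
      have m: "m > 0" "n = m + Suc i" using False Suc by (auto simp: m_def)
      define A where "A = {s. 2 * D * Suc s \<le> n}"
      have A: "A \<subseteq> {..<n}"
      proof
        fix s assume "s \<in> A"
        moreover have "Suc s \<le> 2 * D * Suc s" using D by (cases D) auto
        ultimately show "s \<in> {..<n}" by (simp add: A_def)
      qed
      let ?x = "\<lambda>s. 1 - real (Suc s) / real n"
      have x: "0 \<le> ?x s" "?x s \<le> 1" if "s < n" for s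
        using that by auto
      \<comment> \<open>With few leaves \<open>?x s ^ i\<close> may be near 1 and is bounded by 1;
        the smallness comes from the total weight, with decay in \<open>n\<close> and so in
        \<open>i \<le> n\<close>.\<close>
      have few: "(\<Sum>s\<in>A. leaf_weight w n s * ?x s ^ i) \<le> 2 * exp (- 2 * c * real i) * ?L"
      proof -
        have "(\<Sum>s\<in>A. leaf_weight w n s * ?x s ^ i) \<le> (\<Sum>s\<in>A. leaf_weight w n s * 1)"
          using leaf_weight_nonneg[OF assms(1)] x A
          by (intro sum_mono mult_left_mono power_le_one) auto
        also have "\<dots> \<le> (1 / 2) ^ (n div (2 * D * j)) * ?L"
          using sum_leaf_weight_few_leaves[OF assms(1) D j doubling] by (simp add: A_def)
        also have "\<dots> \<le> 2 * exp (- (ln 2 / real (2 * D * j)) * real i) * ?L"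
          using D j m leaf_weight_nonneg[OF assms(1)]
          by (intro mult_right_mono half_power_div_le sum_nonneg) auto
        also have "\<dots> \<le> 2 * exp (- 2 * c * real i) * ?L"
        proof -
          have "2 * c \<le> ln 2 / real (2 * D * j)" by (simp add: c_def min_def field_simps)
          then have "- (ln 2 / real (2 * D * j)) * real i \<le> - 2 * c * real i"
            by (intro mult_right_mono) auto
          then show ?thesis
            using leaf_weight_nonneg[OF assms(1)] by (intro mult_right_mono mult_left_mono sum_nonneg) auto
        qed
        finally show ?thesis .
      qed
      \<comment> \<open>Here more than a fraction \<open>1 / (2 * D)\<close> of the vertices are
        leaves, so \<open>?x s\<close> is bounded away from 1.\<close>
      have many: "(\<Sum>s\<in>{..<n} - A. leaf_weight w n s * ?x s ^ i) \<le> exp (- 2 * c * real i) * ?L"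
      proof -
        have "?x s ^ i \<le> exp (- 2 * c * real i)" if "s \<in> {..<n} - A" for s
        proof -
          have "n < 2 * D * Suc s" using that by (auto simp: A_def)
          then have "real n \<le> real (2 * D) * real (Suc s)"
            by (metis less_imp_le of_nat_le_iff of_nat_mult)
          then have "1 / real (2 * D) \<le> real (Suc s) / real n"
            using D n by (simp add: field_simps del: of_nat_Suc)
          moreover have "2 * c \<le> 1 / real (2 * D)" by (simp add: c_def min_def field_simps)
          ultimately have "?x s \<le> 1 + (- 2 * c)" by simp
          also have "\<dots> \<le> exp (- 2 * c)" by (rule exp_ge_add_one_self)
          finally have "?x s ^ i \<le> exp (- 2 * c) ^ i"
            using x[of s] that by (intro power_mono) auto
          then show ?thesis by (simp add: exp_of_nat_mult[symmetric] mult_ac)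
        qed
        then have "(\<Sum>s\<in>{..<n} - A. leaf_weight w n s * ?x s ^ i) \<le>
            (\<Sum>s\<in>{..<n} - A. leaf_weight w n s * exp (- 2 * c * real i))"
          using leaf_weight_nonneg[OF assms(1)] by (intro sum_mono mult_left_mono) auto
        also have "\<dots> \<le> (\<Sum>s<n. leaf_weight w n s * exp (- 2 * c * real i))"
          using leaf_weight_nonneg[OF assms(1)] by (intro sum_mono2) auto
        finally show ?thesis
          unfolding sum_distrib_right[symmetric] by (simp only: mult.commute[of ?L])
      qed
      have "real m * deep_weight w k n 1 \<le>
          real (i + 2) * (\<Sum>s<n. leaf_weight w n s * ?x s ^ i)"
        using deep_weight_tree_le[OF assms(1) m] Suc by simp
      also have "(\<Sum>s<n. leaf_weight w n s * ?x s ^ i) =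
          (\<Sum>s\<in>{..<n} - A. leaf_weight w n s * ?x s ^ i) + (\<Sum>s\<in>A. leaf_weight w n s * ?x s ^ i)"
        using A by (intro sum.subset_diff) auto
      also have "real (i + 2) * \<dots> \<le> real (i + 2) * (3 * exp (- 2 * c * real i) * ?L)"
        using few many by (intro mult_left_mono) auto
      also have "?L = real n * ?Z"
        using n by (simp add: partition_function_eq)
      also have "real (i + 2) * (3 * exp (- 2 * c * real i) * (real n * ?Z)) =
          real n * (real (i + 2) * (3 * exp (- 2 * c * real i) * ?Z))"
        by (simp only: mult_ac)
      \<comment> \<open>Since \<open>m \<ge> 1\<close>,
        \<open>n = m + i + 1 \<le> m * (i + 2)\<close>; the quotient \<open>n / m\<close> thus costs
        only another factor \<open>i + 2\<close>.\<close>
      also have "\<dots> \<le> real (m * (i + 2)) * (real (i + 2) * (3 * exp (- 2 * c * real i) * ?Z))"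
      proof -
        have "n \<le> m * (i + 2)" using m by (cases m) auto
        then show ?thesis using Z by (intro mult_right_mono) (auto simp del: of_nat_mult)
      qed
      also have "\<dots> = real m * (3 * (real (i + 2) ^ 2 * exp (- 2 * c * real i)) * ?Z)"
        by (simp only: of_nat_mult power2_eq_square mult_ac)
      finally have "deep_weight w k n 1 \<le> 3 * (real (i + 2) ^ 2 * exp (- 2 * c * real i)) * ?Z"
        using m by (simp only: mult_le_cancel_left_pos of_nat_0_less_iff)
      also have "\<dots> \<le> 3 * (2 / c ^ 2 * exp (2 * c) * exp (- c * real i)) * ?Z"
        using Z square_mult_exp_le[OF c, of i] by (intro mult_right_mono mult_left_mono) auto
      also have "\<dots> = 6 / c ^ 2 * exp (3 * c) * exp (- c * real k) * ?Z"
        by (simp add: Suc algebra_simps flip: exp_add)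
      also have "\<dots> \<le> C * exp (- c * real k) * ?Z"
        using Z by (intro mult_right_mono) (auto simp: C_def)
      finally show ?thesis .
    qed
    then have "deep_weight w k n 1 / ?Z \<le> C * exp (- c * real k)"
      using Z by (simp add: divide_le_eq)
    then show ?thesis
      using prob_border_distance_le[OF assms(1) n(2), of k] by linarith
  qed
  moreover have "C > 0" by (simp add: C_def)
  ultimately show ?thesis using c by (intro exI[of _ 1] exI[of _ C] exI[of _ c]) auto
qed

end
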